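(* Let $d\ge1$ and let $M\le A^{A^d}$ be a $d$-ary clone fragment on the finite set $A$. The following are equivalent: (i) $M^{*_d}$ is a clone; (ii) $M$, considered as an R-relation of simple arity $\alpha=A^d$, is a $d$-dimensional generalized quasiorder; (iii) $M^{*_d}=\mathrm{Pol}\,M$ (where on the right side $M$ is considered as an R-relation of arity $A^d$). Moreover, condition (ii) also implies that $(M^{*_d})^{(n)}$, the set of $n$-ary members of $M^{*_d}$ considered as an R-relation of simple arity $A^n$, is an $n$-dimensional generalized quasiorder for all $n\ge d$.
   Context: $A$ is a finite nonempty set. $\mathrm{Op}(A)$ is the set of all operations $f:A^n\to A$, $n\ge1$. A clone is a subset of $\mathrm{Op}(A)$ containing all projections and closed under composition; $\langle F\rangle$ is the clone generated by $F$, and $F^{(d)}$ the set of $d$-ary members of $F$. A $d$-ary clone fragment is a set $M\subseteq A^{A^d}$ of $d$-ary operations with $M=\langle M\rangle^{(d)}$. $\mathrm{trl}_d(f)$, for $f:A^n\to A$, is the set of all $d$-ary operations obtained from $f$ by substituting constants from $A$ for some (possibly none, possibly all) of its variables, keeping the remaining $t\le d$ variables in their order, and then prepending $u$ and appending $v$ fictitious variables, $u+t+v=d$. For $M\subseteq A^{A^d}$, $M^{*_d}:=\{f\in\mathrm{Op}(A)\mid\mathrm{trl}_d(f)\subseteq M\}$. Let $B$ be a finite nonempty set (here $B=A$). For $h:B^{n+1}\to A$, $\mathrm{ebtrl}(h)$ is the set of all $(x_0,\dots,x_{n-1})\mapsto h(x_0,\dots,x_{i-1},c,x_i,\dots,x_{n-1})$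 with $0\le i\le n$, $c\in B$. For $g:B^n\to A$, $\mathrm{eftrl}(g)$ consists of $(x_0,\dots,x_n)\mapsto g(x_1,\dots,x_n)$ and $(x_0,\dots,x_n)\mapsto g(x_0,\dots,x_{n-1})$. For $\rho\subseteq A^{B^n}$, $\circledast(\rho):=\{h\in A^{B^{n+1}}\mid\mathrm{ebtrl}(h)\subseteq\rho\}$. For $h\in A^{B^{n+1}}$, $\mathbf\Delta(h)$ is the set of all $(x_0,\dots,x_{n-1})\mapsto h(x_0,\dots,x_{j-1},x_i,x_j,\dots,x_{n-1})$, $0\le i<j\le n$. ($\mathrm{eftrl}$, $\mathbf\Delta$ extend to sets by unions.) An R-relation $\rho\subseteq A^{B^n}$ of simple arity $B^n$ is internally reflexive if $\mathrm{eftrl}(\rho)\subseteq\circledast(\rho)$, reflexive if it is internally reflexive and contains all constant functions $B^n\to A$, transitive if $\mathbf\Delta(\circledast(\rho))\subseteq\rho$, and an $n$-dimensional generalized quasiorder if it is reflexive and transitive. $f:A^n\to A$ preserves $\rho\subseteq A^\alpha$ if for all $g_1,\dots,g_n\in\rho$ the function $b\mapsto f(g_1(b),\dots,g_n(b))$ is in $\rho$. $\mathrm{Pol}\,\rho$ is the set of all $f\in\mathrm{Op}(A)$ preserving $\rho$. *)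

theory Defs
  imports Complex_Main "HOL-Library.FuncSet"
begin

text \<open>
  The set \<open>A\<close> is the universe of a type of class \<open>finite\<close>; \<open>n\<close>-tuples are lists of length \<open>n\<close>
  (counted from 0), and a function \<open>B\<^sup>n \<rightarrow> A\<close> is an extensional function on the lists of length \<open>n\<close>.
  If \<open>A\<close> is a singleton, such a function does not determine \<open>n\<close>, so elements of \<open>Op(A)\<close> are
  pairs \<open>(n, f)\<close> of an arity and a function, whereas sets of functions of one fixed arity are
  plain sets of functions.
\<close>

definition tuples :: "nat \<Rightarrow> 'b list set" where
  "tuples n = {xs. length xs = n}"

definition funs :: "nat \<Rightarrow> ('b list \<Rightarrow> 'a) set" where
  "funs n = tuples n \<rightarrow>\<^sub>E UNIV"

type_synonym 'a operation = "nat \<times> ('a list \<Rightarrow> 'a)"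

definition Op :: "'a operation set" where
  "Op = {(n, f). 1 \<le> n \<and> f \<in> funs n}"

definition arity_part :: "nat \<Rightarrow> 'a operation set \<Rightarrow> ('a list \<Rightarrow> 'a) set" where
  "arity_part n F = {f. (n, f) \<in> F}"

definition proj :: "nat \<Rightarrow> nat \<Rightarrow> 'a list \<Rightarrow> 'a" where
  "proj n i = restrict (\<lambda>xs. xs ! i) (tuples n)"

text \<open>The function \<open>b \<mapsto> f(g\<^sub>1(b), \<dots>, g\<^sub>n(b))\<close> on the index set \<open>I\<close>. For \<open>I = A\<^sup>m\<close> this is the
  composition of operations; it also defines preservation of a relation \<open>\<rho> \<subseteq> A\<^sup>I\<close>.\<close>

definition compose_on :: "'i set \<Rightarrow> ('a list \<Rightarrow> 'a) \<Rightarrow> ('i \<Rightarrow> 'a) list \<Rightarrow> 'i \<Rightarrow> 'a" where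
  "compose_on I f gs = restrict (\<lambda>b. f (map (\<lambda>g. g b) gs)) I"

definition clone :: "'a operation set \<Rightarrow> bool" where
  "clone C \<longleftrightarrow> C \<subseteq> Op \<and>
     (\<forall>n i. i < n \<longrightarrow> (n, proj n i) \<in> C) \<and>
     (\<forall>n m f gs. (n, f) \<in> C \<and> length gs = n \<and> (\<forall>g\<in>set gs. (m, g) \<in> C)
        \<longrightarrow> (m, compose_on (tuples m) f gs) \<in> C)"

definition generated_clone :: "'a operation set \<Rightarrow> 'a operation set" where
  "generated_clone F = \<Inter> {C. clone C \<and> F \<subseteq> C}"

definition clone_fragment :: "nat \<Rightarrow> ('a list \<Rightarrow> 'a) set \<Rightarrow> bool" where
  "clone_fragment d M \<longleftrightarrow>
     M \<subseteq> funs d \<and> M = arity_part d (generated_clone ({d} \<times> M))"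

text \<open>A pattern \<open>p\<close> of length \<open>n\<close> says which variables of an \<open>n\<close>-ary function are replaced by a
  constant (\<open>Some c\<close>) and which are kept (\<open>None\<close>); \<open>fill p ys\<close> is the argument tuple in which the
  kept positions receive the entries of \<open>ys\<close> from left to right.\<close>

primrec fill :: "'a option list \<Rightarrow> 'a list \<Rightarrow> 'a list" where
  "fill [] ys = []"
| "fill (q # p) ys = (case q of Some c \<Rightarrow> c # fill p ys | None \<Rightarrow> hd ys # fill p (tl ys))"

text \<open>The first \<open>u\<close> and the last \<open>v\<close> of the \<open>d = u + t + v\<close> variables are fictitious.\<close>

definition trl :: "nat \<Rightarrow> nat \<Rightarrow> ('a list \<Rightarrow> 'a) \<Rightarrow> ('a list \<Rightarrow> 'a) set" where
  "trl d n f =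
     {restrict (\<lambda>xs. f (fill p (take t (drop u xs)))) (tuples d) | p t u v.
        length p = n \<and> t = count_list p None \<and> u + t + v = d}"

definition star :: "nat \<Rightarrow> ('a list \<Rightarrow> 'a) set \<Rightarrow> 'a operation set" where
  "star d M = {(n, f) \<in> Op. trl d n f \<subseteq> M}"

text \<open>Here \<open>n\<close> is the dimension of the relation; so \<open>h\<close> is \<open>(n + 1)\<close>-ary in \<open>ebtrl\<close> and \<open>diag\<close>
  (the operator \<open>\<^bold>\<Delta>\<close>), and \<open>g\<close> is \<open>n\<close>-ary in \<open>eftrl\<close>.\<close>

definition ebtrl :: "nat \<Rightarrow> ('b list \<Rightarrow> 'a) \<Rightarrow> ('b list \<Rightarrow> 'a) set" where
  "ebtrl n h =
     {restrict (\<lambda>xs. h (take i xs @ c # drop i xs)) (tuples n) | i c. i \<le> n}"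

definition eftrl :: "nat \<Rightarrow> ('b list \<Rightarrow> 'a) \<Rightarrow> ('b list \<Rightarrow> 'a) set" where
  "eftrl n g =
     {restrict (\<lambda>xs. g (tl xs)) (tuples (n + 1)),
      restrict (\<lambda>xs. g (butlast xs)) (tuples (n + 1))}"

definition circledast :: "nat \<Rightarrow> ('b list \<Rightarrow> 'a) set \<Rightarrow> ('b list \<Rightarrow> 'a) set" where
  "circledast n \<rho> = {h \<in> funs (n + 1). ebtrl n h \<subseteq> \<rho>}"

definition diag :: "nat \<Rightarrow> ('b list \<Rightarrow> 'a) \<Rightarrow> ('b list \<Rightarrow> 'a) set" where
  "diag n h =
     {restrict (\<lambda>xs. h (take j xs @ xs ! i # drop j xs)) (tuples n) | i j. i < j \<and> j \<le> n}"

definition internally_reflexive :: "nat \<Rightarrow> ('b list \<Rightarrow> 'a) set \<Rightarrow> bool" where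
  "internally_reflexive n \<rho> \<longleftrightarrow> (\<Union>g\<in>\<rho>. eftrl n g) \<subseteq> circledast n \<rho>"

definition reflexive_rel :: "nat \<Rightarrow> ('b list \<Rightarrow> 'a) set \<Rightarrow> bool" where
  "reflexive_rel n \<rho> \<longleftrightarrow>
     internally_reflexive n \<rho> \<and> (\<forall>a. restrict (\<lambda>_. a) (tuples n) \<in> \<rho>)"

definition transitive_rel :: "nat \<Rightarrow> ('b list \<Rightarrow> 'a) set \<Rightarrow> bool" where
  "transitive_rel n \<rho> \<longleftrightarrow> (\<Union>h\<in>circledast n \<rho>. diag n h) \<subseteq> \<rho>"

definition gen_quasiorder :: "nat \<Rightarrow> ('b list \<Rightarrow> 'a) set \<Rightarrow> bool" where
  "gen_quasiorder n \<rho> \<longleftrightarrow> \<rho> \<subseteq> funs n \<and> reflexive_rel n \<rho> \<and> transitive_rel n \<rho>"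

definition preserves :: "'i set \<Rightarrow> nat \<Rightarrow> ('a list \<Rightarrow> 'a) \<Rightarrow> ('i \<Rightarrow> 'a) set \<Rightarrow> bool" where
  "preserves I n f \<rho> \<longleftrightarrow>
     (\<forall>gs. length gs = n \<and> set gs \<subseteq> \<rho> \<longrightarrow> compose_on I f gs \<in> \<rho>)"

definition Pol :: "'i set \<Rightarrow> ('i \<Rightarrow> 'a) set \<Rightarrow> 'a operation set" where
  "Pol I \<rho> = {(n, f) \<in> Op. preserves I n f \<rho>}"

end

theory Submission
  imports Defs
begin

text \<open>
  The crux is that \<open>star d M \<subseteq> Pol M\<close> if \<open>M\<close> is a generalized quasiorder. For \<open>f\<close> in \<open>star d M\<close> and
  \<open>g\<^sub>1, \<dots>, g\<^sub>n\<close> in \<open>M\<close>, the function \<open>f(g\<^sub>1(x\<^sub>1), \<dots>, g\<^sub>n(x\<^sub>n))\<close> of \<open>n d\<close> separate variables has all its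
  \<open>d\<close>-ary translations in \<open>M\<close>: at most \<open>d\<close> variables are kept, so at most \<open>d\<close> of the \<open>g\<^sub>i\<close> are not
  turned into constants. Transitivity of \<open>M\<close> then allows one to identify variables one pair at a time,
  down to \<open>f(g\<^sub>1(x), \<dots>, g\<^sub>n(x))\<close>. Conversely, an \<open>(n+1)\<close>-ary function with \<open>n \<ge> d\<close> lies in \<open>star d M\<close> as
  soon as fixing any one of its variables leads into \<open>star d M\<close>, so if \<open>star d M\<close> is a clone, then its
  \<open>n\<close>-ary part is transitive.
\<close>

section \<open>Tuples, patterns and translations\<close>

lemma tuples_iff [simp]: "xs \<in> tuples n \<longleftrightarrow> length xs = n"
  by (simp add: tuples_def)

lemma restrict_funs [simp]: "restrict f (tuples n) \<in> funs n"
  by (simp add: funs_def)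

lemma funs_eqI:
  assumes "f \<in> funs n" "g \<in> funs n" "\<And>xs. length xs = n \<Longrightarrow> f xs = g xs"
  shows "f = g"
  by (rule PiE_ext[OF assms(1,2)[unfolded funs_def]]) (simp add: assms(3))

lemma compose_on_funs [simp]: "compose_on (tuples m) f gs \<in> funs m"
  by (simp add: compose_on_def)

lemma compose_on_apply [simp]: "b \<in> I \<Longrightarrow> compose_on I f gs b = f (map (\<lambda>g. g b) gs)"
  by (simp add: compose_on_def)

lemma proj_funs [simp]: "proj n i \<in> funs n"
  by (simp add: proj_def)

lemma proj_apply [simp]: "length xs = n \<Longrightarrow> proj n i xs = xs ! i"
  by (simp add: proj_def)

lemma length_fill [simp]: "length (fill p ys) = length p"
  by (induction p arbitrary: ys) (auto split: option.split)

lemma fill_replicate_None: "length ys = n \<Longrightarrow> fill (replicate n None) ys = ys"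
  by (induction n arbitrary: ys) (auto simp: length_Suc_conv)

text \<open>A constant consumes no entry of \<open>ys\<close>, so it can be inserted after the rest
  of the pattern has been filled; this turns a translation into an \<open>ebtrl\<close> step
  followed by a translation.\<close>

lemma fill_insert_Some:
  "fill (p @ Some c # q) ys = take (length p) (fill (p @ q) ys) @ c # drop (length p) (fill (p @ q) ys)"
  by (induction p arbitrary: ys) (auto split: option.split)

text \<open>Puts \<open>fill\<close> into the form that \<open>clone_substitute\<close> asks for.
  Each kept position uses up one variable, hence the induction over all \<open>u\<close>.\<close>

lemma fill_nth:
  assumes "count_list p None + u \<le> d" "k < length p"
  shows "(\<exists>c. \<forall>xs\<in>tuples d. fill p (take (count_list p None) (drop u xs)) ! k = c) \<or>
         (\<exists>j<d. \<forall>xs\<in>tuples d. fill p (take (count_list p None) (drop u xs)) ! k = xs ! j)"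
  using assms
proof (induction p arbitrary: u k)
  case (Cons q p)
  show ?case
  proof (cases q)
    case (Some c)
    then show ?thesis
      using Cons by (cases k) auto
  next
    case None
    have *: "take (Suc t) (drop u xs) = xs ! u # take t (drop (Suc u) xs)" if "length xs = d" for xs :: "'a list" and t
      using that None Cons.prems by (simp flip: Cons_nth_drop_Suc)
    show ?thesis
    proof (cases k)
      case 0
      then show ?thesis
        using None Cons.prems by (auto simp: * intro!: exI[of _ u])
    next
      case (Suc k')
      then show ?thesis
        using None Cons.prems Cons.IH[of "Suc u" k'] by (auto simp: *)
    qed
  qed
qed simp

text \<open>The values at the \<open>None\<close> positions suffice to recover the whole argument
  tuple, since \<open>p\<close> records those at the other positions.\<close>

lemma fill_filter_None:
  assumes "list_all2 (\<lambda>q h. \<forall>c. q = Some c \<longrightarrow> h xs = c) p hs"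
  shows "fill p (map (\<lambda>h. h xs) (map snd (filter (\<lambda>(q, h). q = None) (zip p hs)))) = map (\<lambda>h. h xs) hs"
  using assms by (induction rule: list_all2_induct) (auto split: option.split)

lemma length_filter_None:
  "length p = length hs \<Longrightarrow> length (filter (\<lambda>(q, h). q = None) (zip p hs)) = count_list p None"
  by (induction p hs rule: list_induct2) auto

lemma trlI:
  assumes "length p = n" "u + count_list p None \<le> d"
  shows "restrict (\<lambda>xs. f (fill p (take (count_list p None) (drop u xs)))) (tuples d) \<in> trl d n f"
  unfolding trl_def mem_Collect_eq
  by (rule exI[of _ p], rule exI[of _ "count_list p None"], rule exI[of _ u],
      rule exI[of _ "d - u - count_list p None"]) (use assms in simp)

lemma trlE:
  assumes "g \<in> trl d n f"
  obtains p u where "length p = n" "count_list p None + u \<le> d"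
    "g = restrict (\<lambda>xs. f (fill p (take (count_list p None) (drop u xs)))) (tuples d)"
  using assms unfolding trl_def mem_Collect_eq by (metis add.commute le_add1)

section \<open>Clones and polymorphisms\<close>

lemma clone_proj: "clone C \<Longrightarrow> i < n \<Longrightarrow> (n, proj n i) \<in> C"
  unfolding clone_def by blast

lemma clone_compose:
  "clone C \<Longrightarrow> (n, f) \<in> C \<Longrightarrow> length gs = n \<Longrightarrow> (\<And>g. g \<in> set gs \<Longrightarrow> (m, g) \<in> C)
    \<Longrightarrow> (m, compose_on (tuples m) f gs) \<in> C"
  unfolding clone_def by blast

text \<open>Each coordinate of \<open>\<phi>\<close> agrees with a constant or a projection, so this
  is a composition in \<open>C\<close>. It covers translations, fictitious variables and
  identification of variables at once.\<close>

lemma clone_substitute: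
  assumes C: "clone C" and const: "\<And>c. (m, restrict (\<lambda>_. c) (tuples m)) \<in> C"
    and f: "(n, f) \<in> C"
    and len: "\<And>xs. length xs = m \<Longrightarrow> length (\<phi> xs) = n"
    and nth: "\<And>k. k < n \<Longrightarrow> (\<exists>c. \<forall>xs\<in>tuples m. \<phi> xs ! k = c) \<or> (\<exists>j<m. \<forall>xs\<in>tuples m. \<phi> xs ! k = xs ! j)"
  shows "(m, restrict (\<lambda>xs. f (\<phi> xs)) (tuples m)) \<in> C"
proof -
  have "\<exists>g. (m, g) \<in> C \<and> (\<forall>xs\<in>tuples m. \<phi> xs ! k = g xs)" if "k < n" for k
    using nth[OF that]
  proof (elim disjE exE conjE)
    fix c assume "\<forall>xs\<in>tuples m. \<phi> xs ! k = c"
    then show ?thesis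
      using const[of c] by (intro exI[of _ "restrict (\<lambda>_. c) (tuples m)"]) simp
  next
    fix j assume "j < m" "\<forall>xs\<in>tuples m. \<phi> xs ! k = xs ! j"
    then show ?thesis
      using clone_proj[OF C, of j m] by (intro exI[of _ "proj m j"]) simp
  qed
  then obtain G where G: "\<And>k. k < n \<Longrightarrow> (m, G k) \<in> C \<and> (\<forall>xs\<in>tuples m. \<phi> xs ! k = G k xs)"
    by metis
  have "(m, compose_on (tuples m) f (map G [0..<n])) \<in> C"
    using G by (intro clone_compose[OF C f]) auto
  moreover have "map (\<lambda>g. g xs) (map G [0..<n]) = \<phi> xs" if "length xs = m" for xs
    by (rule nth_equalityI) (use that G len in simp_all)
  then have "compose_on (tuples m) f (map G [0..<n]) = restrict (\<lambda>xs. f (\<phi> xs)) (tuples m)"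
    by (auto intro!: funs_eqI[of _ m])
  ultimately show ?thesis by simp
qed

text \<open>Extensionality makes composing a projection with \<open>gs\<close> return
  \<open>gs ! i\<close> itself.\<close>

lemma clone_Pol:
  assumes "\<rho> \<subseteq> extensional I"
  shows "clone (Pol I \<rho>)"
  unfolding clone_def
proof (intro conjI allI impI)
  show "Pol I \<rho> \<subseteq> Op"
    by (auto simp: Pol_def)
next
  fix n i :: nat
  assume "i < n"
  moreover have "compose_on I (proj n i) gs \<in> \<rho>" if "length gs = n" "set gs \<subseteq> \<rho>" for gs
  proof -
    have "gs ! i \<in> \<rho>"
      using that \<open>i < n\<close> by (metis nth_mem subsetD)
    moreover have "compose_on I (proj n i) gs = gs ! i"
      using calculation assms that \<open>i < n\<close>
      by (auto intro!: extensionalityI[of _ I] simp: compose_on_def)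
    ultimately show ?thesis by simp
  qed
  ultimately show "(n, proj n i) \<in> Pol I \<rho>"
    by (auto simp: Pol_def Op_def preserves_def)
next
  fix n m :: nat and f gs
  assume *: "(n, f) \<in> Pol I \<rho> \<and> length gs = n \<and> (\<forall>g\<in>set gs. (m, g) \<in> Pol I \<rho>)"
  \<comment> \<open>No operation is nullary, so \<open>gs\<close> has a member, and its arity gives
    \<open>1 \<le> m\<close>.\<close>
  then have "gs \<noteq> []"
    by (auto simp: Pol_def Op_def)
  then have m: "1 \<le> m"
    using * by (cases gs) (auto simp: Pol_def Op_def)
  have "compose_on I (compose_on (tuples m) f gs) hs \<in> \<rho>" if hs: "length hs = m" "set hs \<subseteq> \<rho>" for hs
  proof -
    have "set (map (\<lambda>g. compose_on I g hs) gs) \<subseteq> \<rho>"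
      using * hs by (auto simp: Pol_def preserves_def)
    then have "compose_on I f (map (\<lambda>g. compose_on I g hs) gs) \<in> \<rho>"
      using * by (auto simp: Pol_def preserves_def)
    also have "compose_on I f (map (\<lambda>g. compose_on I g hs) gs) = compose_on I (compose_on (tuples m) f gs) hs"
      using hs by (auto simp: compose_on_def o_def intro!: restrict_ext arg_cong[of _ _ f])
    finally show ?thesis .
  qed
  then show "(m, compose_on (tuples m) f gs) \<in> Pol I \<rho>"
    using m by (auto simp: Pol_def Op_def preserves_def)
qed

section \<open>Clone fragments and identification of variables\<close>

definition instantiate :: "'a + nat \<Rightarrow> 'a list \<Rightarrow> 'a" where
  "instantiate q xs = (case q of Inl c \<Rightarrow> c | Inr j \<Rightarrow> xs ! j)"

lemma instantiate_simps [simp]: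
  "instantiate (Inl c) xs = c" "instantiate (Inr j) xs = xs ! j"
  by (simp_all add: instantiate_def)

text \<open>The closure properties of a \<open>d\<close>-ary clone fragment, freed from the
  generated clone.\<close>

locale fragment =
  fixes d :: nat and M :: "('a list \<Rightarrow> 'a) set"
  assumes d_pos: "1 \<le> d"
    and M_funs: "M \<subseteq> funs d"
    and proj_M: "i < d \<Longrightarrow> proj d i \<in> M"
    and compose_M: "f \<in> M \<Longrightarrow> length gs = d \<Longrightarrow> set gs \<subseteq> M \<Longrightarrow> compose_on (tuples d) f gs \<in> M"
begin

lemma compose_map_M:
  assumes "f \<in> M" "\<And>k. k < d \<Longrightarrow> restrict (\<lambda>xs. G k xs) (tuples d) \<in> M"
  shows "restrict (\<lambda>xs. f (map (\<lambda>k. G k xs) [0..<d])) (tuples d) \<in> M"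
proof -
  have "compose_on (tuples d) f (map (\<lambda>k. restrict (\<lambda>xs. G k xs) (tuples d)) [0..<d]) \<in> M"
    using assms by (intro compose_M) auto
  also have "compose_on (tuples d) f (map (\<lambda>k. restrict (\<lambda>xs. G k xs) (tuples d)) [0..<d]) =
      restrict (\<lambda>xs. f (map (\<lambda>k. G k xs) [0..<d])) (tuples d)"
    by (auto intro!: funs_eqI[of _ d] arg_cong[of _ _ f])
  finally show ?thesis .
qed

text \<open>Plugging the constants recorded in \<open>p\<close> into \<open>f\<close> gives a
  translation \<open>g\<close>, which lies in \<open>M\<close>; the remaining members of
  \<open>hs\<close> are at most \<open>d\<close> in number and can be composed with \<open>g\<close>
  inside \<open>M\<close>.\<close>

lemma compose_star_M:
  assumes f: "(n, f) \<in> star d M" and hs: "set hs \<subseteq> M"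
    and p: "list_all2 (\<lambda>q h. \<forall>c. q = Some c \<longrightarrow> (\<forall>xs\<in>tuples d. h xs = c)) p hs" "length p = n"
    and le: "count_list p None \<le> d"
  shows "compose_on (tuples d) f hs \<in> M"
proof -
  define t where "t = count_list p None"
  define ks where "ks = map snd (filter (\<lambda>(q, h). q = None) (zip p hs))"
  define g where "g = restrict (\<lambda>xs. f (fill p (take t (drop 0 xs)))) (tuples d)"
  have lks: "length ks = t"
    using list_all2_lengthD[OF p(1)] by (simp add: ks_def t_def length_filter_None)
  have "g \<in> trl d n f"
    unfolding g_def t_def using p le by (intro trlI) auto
  then have "g \<in> M"
    using f by (auto simp: star_def)
  moreover have "set ks \<subseteq> set hs"
    by (auto simp: ks_def dest: set_zip_rightD)
  \<comment> \<open>\<open>g\<close> depends at most on its first \<open>t\<close> variables;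
    \<open>proj d 0\<close>, available as \<open>d \<ge> 1\<close>, pads the list to length
    \<open>d\<close>.\<close>
  ultimately have "compose_on (tuples d) g (ks @ replicate (d - t) (proj d 0)) \<in> M"
    using hs lks le d_pos proj_M[of 0] by (intro compose_M) (auto simp: t_def)
  also have "compose_on (tuples d) g (ks @ replicate (d - t) (proj d 0)) = compose_on (tuples d) f hs"
  proof (rule funs_eqI[of _ d])
    fix xs :: "'a list"
    assume xs: "length xs = d"
    have "list_all2 (\<lambda>q h. \<forall>c. q = Some c \<longrightarrow> h xs = c) p hs"
      using p(1) by (rule list_all2_mono) (use xs in auto)
    from fill_filter_None[OF this]
    show "compose_on (tuples d) g (ks @ replicate (d - t) (proj d 0)) xs = compose_on (tuples d) f hs xs"
      using xs lks le by (simp add: g_def t_def[symmetric] ks_def[symmetric])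
  qed auto
  finally show ?thesis .
qed

text \<open>
  The variables of \<open>F\<close> are indexed by an arbitrary type, and \<open>\<sigma>\<close> replaces each of them by a constant
  (\<open>Inl\<close>) or by one of \<open>d\<close> variables (\<open>Inr\<close>). If more than \<open>d\<close> variables are kept, two of them are
  identified by \<open>\<sigma>\<close>. If some of the \<open>d\<close> variables is unused, it can serve to separate the two; if
  all are used, separating the two by a \<open>d+1\<close>st variable gives a function in \<open>circledast d M\<close>.
\<close>

lemma substitution_M:
  fixes F :: "('k \<Rightarrow> 'a) \<Rightarrow> 'a" and \<sigma> :: "'k \<Rightarrow> 'a + nat"
  assumes trans: "transitive_rel d M"
    and few: "\<And>\<sigma>. finite {k. \<not> isl (\<sigma> k)} \<Longrightarrow> card {k. \<not> isl (\<sigma> k)} \<le> d \<Longrightarrow>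
      (\<And>k j. \<sigma> k = Inr j \<Longrightarrow> j < d) \<Longrightarrow>
      restrict (\<lambda>xs. F (\<lambda>k. instantiate (\<sigma> k) xs)) (tuples d) \<in> M"
    and "finite {k. \<not> isl (\<sigma> k)}" and "\<And>k j. \<sigma> k = Inr j \<Longrightarrow> j < d"
  shows "restrict (\<lambda>xs. F (\<lambda>k. instantiate (\<sigma> k) xs)) (tuples d) \<in> M"
  using assms(3,4)
proof (induction \<sigma> rule: wf_induct_rule[OF wf_measures[of "[\<lambda>\<sigma>. card {k. \<not> isl (\<sigma> k)},
    \<lambda>\<sigma>. card {i. i < d \<and> Inr i \<notin> range \<sigma>}]"]])
  case (1 \<sigma>)
  let ?V = "\<lambda>\<sigma>::'k \<Rightarrow> 'a + nat. {k. \<not> isl (\<sigma> k)}"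
  let ?U = "\<lambda>\<sigma>::'k \<Rightarrow> 'a + nat. {i. i < d \<and> Inr i \<notin> range \<sigma>}"
  let ?S = "\<lambda>\<sigma>::'k \<Rightarrow> 'a + nat. restrict (\<lambda>xs. F (\<lambda>k. instantiate (\<sigma> k) xs)) (tuples d)"
  note bound = 1(3)
  have IH: "?S \<tau> \<in> M"
    if "card (?V \<tau>) < card (?V \<sigma>) \<or> card (?V \<tau>) = card (?V \<sigma>) \<and> card (?U \<tau>) < card (?U \<sigma>)"
      and "finite (?V \<tau>)" "\<And>k j. \<tau> k = Inr j \<Longrightarrow> j < d" for \<tau>
    by (rule 1(1)) (use that in auto)
  show ?case
  proof (cases "card (?V \<sigma>) \<le> d")
    case True
    then show ?thesis using few 1 by blast
  next
    case False
    have "(\<lambda>k. projr (\<sigma> k)) ` ?V \<sigma> \<subseteq> {..<d}"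
    proof
      fix j assume "j \<in> (\<lambda>k. projr (\<sigma> k)) ` ?V \<sigma>"
      then obtain k where "\<not> isl (\<sigma> k)" "j = projr (\<sigma> k)" by auto
      then show "j \<in> {..<d}" using bound[of k j] by (cases "\<sigma> k") auto
    qed
    then have "\<not> inj_on (\<lambda>k. projr (\<sigma> k)) (?V \<sigma>)"
      using False card_inj_on_le[of _ "?V \<sigma>" "{..<d}"] by fastforce
    then obtain a b where ab: "a \<noteq> b" "\<not> isl (\<sigma> a)" "\<not> isl (\<sigma> b)" "projr (\<sigma> a) = projr (\<sigma> b)"
      unfolding inj_on_def by auto
    then obtain j where j: "\<sigma> a = Inr j" "\<sigma> b = Inr j"
      by (metis sum.collapse(2))
    have jd: "j < d" using bound j by blast
    show ?thesis
    proof (cases "?U \<sigma> = {}")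
      case False
      then obtain i where i: "i < d" "Inr i \<notin> range \<sigma>" by auto
      define \<tau> where "\<tau> = \<sigma>(b := Inr i)"
      have V: "?V \<tau> = ?V \<sigma>"
        using j by (auto simp: \<tau>_def)
      have "range \<sigma> \<subseteq> range \<tau>"
      proof
        fix q assume "q \<in> range \<sigma>"
        then obtain k where "q = \<sigma> k" by auto
        then have "q = \<tau> (if k = b then a else k)"
          using ab j by (auto simp: \<tau>_def)
        then show "q \<in> range \<tau>" by blast
      qed
      moreover have "Inr i \<in> range \<tau>"
        unfolding \<tau>_def by (metis fun_upd_same rangeI)
      ultimately have "?U \<tau> \<subset> ?U \<sigma>" using i by blast
      then have "card (?U \<tau>) < card (?U \<sigma>)"
        by (intro psubset_card_mono) auto
      then have "?S \<tau> \<in> M"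
        using 1(2) bound V i by (intro IH) (simp_all add: \<tau>_def split: if_splits)
      \<comment> \<open>Copying entry \<open>j\<close> to position \<open>i\<close> undoes the
        separation; the coordinates of this map are projections.\<close>
      moreover have "restrict (\<lambda>xs. xs[i := xs ! j] ! k) (tuples d) \<in> M" if "k < d" for k
      proof -
        have eq: "restrict (\<lambda>xs. xs[i := xs ! j] ! k) (tuples d) = proj d (if k = i then j else k)"
          using that by (auto intro!: funs_eqI[of _ d])
        show ?thesis unfolding eq using that jd by (intro proj_M) auto
      qed
      ultimately have "restrict (\<lambda>xs. ?S \<tau> (map (\<lambda>k. xs[i := xs ! j] ! k) [0..<d])) (tuples d) \<in> M"
        by (rule compose_map_M)
      also have "restrict (\<lambda>xs. ?S \<tau> (map (\<lambda>k. xs[i := xs ! j] ! k) [0..<d])) (tuples d) = ?S \<sigma>"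
      proof (rule funs_eqI[of _ d])
        fix xs :: "'a list"
        assume xs: "length xs = d"
        then have "map (\<lambda>k. xs[i := xs ! j] ! k) [0..<d] = xs[i := xs ! j]"
          by (auto intro: nth_equalityI)
        moreover have "instantiate (\<tau> k) (xs[i := xs ! j]) = instantiate (\<sigma> k) xs" for k
        proof (cases "\<sigma> k")
          case (Inr l)
          then have "l \<noteq> i" using i(2) by (metis rangeI)
          then show ?thesis using Inr i xs j by (auto simp: \<tau>_def)
        qed (use j in \<open>auto simp: \<tau>_def\<close>)
        ultimately show "restrict (\<lambda>xs. ?S \<tau> (map (\<lambda>k. xs[i := xs ! j] ! k) [0..<d])) (tuples d) xs = ?S \<sigma> xs"
          using xs by simp
      qed auto
      finally show ?thesis .
    next
      case True
      define \<tau> where "\<tau> = \<sigma>(b := Inr d)"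
      define h where "h = restrict (\<lambda>xs. F (\<lambda>k. instantiate (\<tau> k) xs)) (tuples (d + 1))"
      \<comment> \<open>This makes the first measure drop below: fixing any of the
        \<open>d + 1\<close> variables turns at least one kept variable of \<open>F\<close> into a
        constant.\<close>
      have used: "\<exists>k. \<tau> k = Inr i" if "i \<le> d" for i
      proof (cases "i = d")
        case False
        then have "Inr i \<in> range \<sigma>" using True \<open>i \<le> d\<close> by auto
        then obtain k where k: "\<sigma> k = Inr i" by (metis imageE)
        then show ?thesis
          using ab j by (cases "k = b") (auto simp: \<tau>_def intro: exI[of _ a] exI[of _ k])
      qed (auto simp: \<tau>_def)
      have "restrict (\<lambda>xs. h (take i xs @ c # drop i xs)) (tuples d) \<in> M" if "i \<le> d" for i c
      proof -
        define \<theta> where "\<theta> k = (case \<tau> k of Inl c' \<Rightarrow> Inl c' |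
          Inr l \<Rightarrow> if l < i then Inr l else if l = i then Inl c else Inr (l - 1))" for k
        obtain k where k: "\<tau> k = Inr i" using used[OF \<open>i \<le> d\<close>] by blast
        have "isl (\<theta> l)" if "isl (\<sigma> l)" for l
          using that ab by (cases "\<sigma> l") (auto simp: \<theta>_def \<tau>_def)
        then have "?V \<theta> \<subseteq> ?V \<sigma>"
          by blast
        moreover have "k \<in> ?V \<sigma> - ?V \<theta>"
          using k ab by (auto simp: \<theta>_def \<tau>_def split: if_splits)
        ultimately have "?V \<theta> \<subset> ?V \<sigma>" by blast
        then have "card (?V \<theta>) < card (?V \<sigma>)" "finite (?V \<theta>)"
          using 1(2) by (auto intro: psubset_card_mono finite_subset)
        moreover have "\<tau> k = Inr l \<Longrightarrow> l \<le> d" for k l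
          using bound[of k l] by (auto simp: \<tau>_def split: if_splits)
        then have "\<theta> k = Inr l \<Longrightarrow> l < d" for k l
          using that by (fastforce simp: \<theta>_def split: sum.splits if_splits)
        ultimately have "?S \<theta> \<in> M"
          by (intro IH) auto
        also have "?S \<theta> = restrict (\<lambda>xs. h (take i xs @ c # drop i xs)) (tuples d)"
        proof (rule funs_eqI[of _ d])
          fix xs :: "'a list"
          assume xs: "length xs = d"
          have "instantiate (\<tau> k) (take i xs @ c # drop i xs) = instantiate (\<theta> k) xs" for k
            using xs that by (auto simp: \<theta>_def nth_append nth_Cons' split: sum.split)
          then show "?S \<theta> xs = restrict (\<lambda>xs. h (take i xs @ c # drop i xs)) (tuples d) xs"
            using xs that by (simp add: h_def)
        qed auto
        finally show ?thesis .
      qed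
      then have "h \<in> circledast d M"
        by (auto simp: circledast_def ebtrl_def h_def)
      \<comment> \<open>Copying entry \<open>j\<close> to the end identifies the new variable with
        variable \<open>j\<close>, which gives back \<open>\<sigma>\<close>.\<close>
      moreover have "restrict (\<lambda>xs. h (take d xs @ xs ! j # drop d xs)) (tuples d) \<in> diag d h"
        using jd by (auto simp: diag_def)
      ultimately have "restrict (\<lambda>xs. h (take d xs @ xs ! j # drop d xs)) (tuples d) \<in> M"
        using trans by (auto simp: transitive_rel_def)
      also have "restrict (\<lambda>xs. h (take d xs @ xs ! j # drop d xs)) (tuples d) = ?S \<sigma>"
      proof (rule funs_eqI[of _ d])
        fix xs :: "'a list"
        assume xs: "length xs = d"
        have "instantiate (\<tau> k) (xs @ [xs ! j]) = instantiate (\<sigma> k) xs" for k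
          using xs bound[of k] j by (cases "\<sigma> k") (auto simp: \<tau>_def nth_append)
        then show "restrict (\<lambda>xs. h (take d xs @ xs ! j # drop d xs)) (tuples d) xs = ?S \<sigma> xs"
          using xs by (simp add: h_def)
      qed auto
      finally show ?thesis .
    qed
  qed
qed

section \<open>From translations to polymorphisms\<close>

lemma star_subset_Pol:
  assumes const: "\<And>c. restrict (\<lambda>_. c) (tuples d) \<in> M" and trans: "transitive_rel d M"
  shows "star d M \<subseteq> Pol (tuples d) M"
proof (clarify)
  fix n f
  assume f: "(n, f) \<in> star d M"
  have "compose_on (tuples d) f gs \<in> M" if gs: "length gs = n" "set gs \<subseteq> M" for gs
  proof -
    \<comment> \<open>\<open>v (i, l)\<close> is the \<open>l\<close>-th argument of the
      \<open>i\<close>-th inner function, so that no two inner functions share a variable.\<close>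
    define F where "F v = f (map (\<lambda>i. (gs ! i) (map (\<lambda>l. v (i, l)) [0..<d])) [0..<n])"
      for v :: "nat \<times> nat \<Rightarrow> 'a"
    \<comment> \<open>Gives all inner functions the same tuple of arguments. The default constant
      off the \<open>n \<times> d\<close> grid keeps the set of kept variables finite.\<close>
    define \<sigma> where "\<sigma> = (\<lambda>(i, l). if i < n \<and> l < d then Inr l else Inl (undefined :: 'a))"
    have gsM: "gs ! i \<in> M" if "i < n" for i
      using that gs by (metis nth_mem subsetD)
    have "restrict (\<lambda>xs. F (\<lambda>k. instantiate (\<sigma> k) xs)) (tuples d) \<in> M"
    proof (rule substitution_M[OF trans, where F = F and \<sigma> = \<sigma>])
      have "{k. \<not> isl (\<sigma> k)} \<subseteq> {..<n} \<times> {..<d}"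
        by (auto simp: \<sigma>_def split: if_splits)
      then show "finite {k. \<not> isl (\<sigma> k)}"
        by (rule finite_subset) auto
      show "\<sigma> k = Inr j \<Longrightarrow> j < d" for k j
        by (auto simp: \<sigma>_def split: if_splits prod.splits)
    next
      fix \<tau> :: "nat \<times> nat \<Rightarrow> 'a + nat"
      let ?V = "{k. \<not> isl (\<tau> k)}"
      assume fin: "finite ?V" and le: "card ?V \<le> d" and bound: "\<And>k j. \<tau> k = Inr j \<Longrightarrow> j < d"
      define h where "h i = restrict (\<lambda>xs. (gs ! i) (map (\<lambda>l. instantiate (\<tau> (i, l)) xs) [0..<d])) (tuples d)" for i
      \<comment> \<open>An inner function without kept variables is constant, as all its arguments
        are then of the form \<open>Inl\<close>.\<close>
      define q where "q i = (if i \<in> fst ` ?V then None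
        else Some ((gs ! i) (map (\<lambda>l. projl (\<tau> (i, l))) [0..<d])))" for i
      have inst: "restrict (\<lambda>xs. instantiate (\<tau> k) xs) (tuples d) \<in> M" for k
        using const proj_M bound[of k] by (cases "\<tau> k") (auto simp: proj_def)
      have "h i \<in> M" if "i < n" for i
        unfolding h_def by (intro compose_map_M gsM that inst)
      moreover have "h i xs = c" if "q i = Some c" "length xs = d" for i c xs
      proof -
        have "instantiate (\<tau> (i, l)) xs = projl (\<tau> (i, l))" for l
        proof (cases "\<tau> (i, l)")
          case (Inr b)
          then have "i \<in> fst ` ?V" by (intro image_eqI[of _ _ "(i, l)"]) auto
          then show ?thesis using that by (simp add: q_def)
        qed simp
        then show ?thesis
          using that by (auto simp: h_def q_def split: if_splits)
      qed
      \<comment> \<open>Every \<open>None\<close> is caused by a kept variable with first component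
        \<open>i\<close>, so there are at most \<open>card ?V\<close> of them.\<close>
      moreover have "count_list (map q [0..<n]) None \<le> d"
      proof -
        have "count_list (map q [0..<n]) None = card {i. i < n \<and> q i = None}"
          by (auto simp: count_list_eq_length_filter length_filter_conv_card intro: arg_cong[of _ _ card])
        also have "\<dots> \<le> card (fst ` ?V)"
          using fin by (intro card_mono) (auto simp: q_def split: if_splits)
        also have "\<dots> \<le> card ?V"
          using fin by (rule card_image_le)
        finally show ?thesis using le by simp
      qed
      ultimately have "compose_on (tuples d) f (map h [0..<n]) \<in> M"
        by (intro compose_star_M[OF f, where p = "map q [0..<n]"]) (auto simp: list_all2_conv_all_nth)
      also have "compose_on (tuples d) f (map h [0..<n]) = restrict (\<lambda>xs. F (\<lambda>k. instantiate (\<tau> k) xs)) (tuples d)"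
        by (auto intro!: funs_eqI[of _ d] arg_cong[of _ _ f] simp: F_def h_def)
      finally show "restrict (\<lambda>xs. F (\<lambda>k. instantiate (\<tau> k) xs)) (tuples d) \<in> M" .
    qed
    also have "restrict (\<lambda>xs. F (\<lambda>k. instantiate (\<sigma> k) xs)) (tuples d) = compose_on (tuples d) f gs"
    proof (rule funs_eqI[of _ d])
      fix xs :: "'a list"
      assume xs: "length xs = d"
      have "map (\<lambda>l. instantiate (\<sigma> (i, l)) xs) [0..<d] = xs" if "i < n" for i
        using that xs by (auto intro: nth_equalityI simp: \<sigma>_def)
      then have "map (\<lambda>i. (gs ! i) (map (\<lambda>l. instantiate (\<sigma> (i, l)) xs) [0..<d])) [0..<n] = map (\<lambda>g. g xs) gs"
        using gs by (auto intro!: nth_equalityI)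
      then show "restrict (\<lambda>xs. F (\<lambda>k. instantiate (\<sigma> k) xs)) (tuples d) xs = compose_on (tuples d) f gs xs"
        using xs by (simp add: F_def)
    qed auto
    finally show ?thesis .
  qed
  then show "(n, f) \<in> Pol (tuples d) M"
    using f by (auto simp: Pol_def star_def preserves_def)
qed

section \<open>From polymorphisms to translations\<close>

lemma clone_Pol_M: "clone (Pol (tuples d) M)"
  using M_funs by (intro clone_Pol) (auto simp: funs_def PiE_def)

lemma M_subset_Pol: "f \<in> M \<Longrightarrow> (d, f) \<in> Pol (tuples d) M"
  using M_funs d_pos compose_M by (auto simp: Pol_def Op_def preserves_def)

lemma const_Pol:
  assumes "\<And>c. restrict (\<lambda>_. c) (tuples d) \<in> M" "1 \<le> n"
  shows "(n, restrict (\<lambda>_. c) (tuples n)) \<in> Pol (tuples d) M"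
proof -
  have "compose_on (tuples d) (restrict (\<lambda>_. c) (tuples n)) gs = restrict (\<lambda>_. c) (tuples d)"
    if "length gs = n" for gs :: "('a list \<Rightarrow> 'a) list"
    using that by (auto intro!: funs_eqI[of _ d])
  then show ?thesis
    using assms by (auto simp: Pol_def Op_def preserves_def)
qed

text \<open>Preservation is applied to the projections, which lie in \<open>M\<close>.\<close>

lemma Pol_arity_part: "(d, f) \<in> Pol (tuples d) M \<Longrightarrow> f \<in> M"
proof -
  assume f: "(d, f) \<in> Pol (tuples d) M"
  then have "compose_on (tuples d) f (map (proj d) [0..<d]) \<in> M"
    using proj_M by (auto simp: Pol_def preserves_def image_subset_iff)
  also have "compose_on (tuples d) f (map (proj d) [0..<d]) = f"
  proof (rule funs_eqI[of _ d])
    fix xs :: "'a list"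
    assume xs: "length xs = d"
    then have "map (\<lambda>g. g xs) (map (proj d) [0..<d]) = xs"
      by (auto intro: nth_equalityI)
    with xs show "compose_on (tuples d) f (map (proj d) [0..<d]) xs = f xs"
      by simp
  qed (use f in \<open>auto simp: Pol_def Op_def\<close>)
  finally show ?thesis .
qed

text \<open>A translation only substitutes constants and variables, so it stays in the clone
  \<open>Pol (tuples d) M\<close>, whose \<open>d\<close>-ary members lie in
  \<open>M\<close>.\<close>

lemma Pol_subset_star:
  assumes const: "\<And>c. restrict (\<lambda>_. c) (tuples d) \<in> M"
  shows "Pol (tuples d) M \<subseteq> star d M"
proof (clarify)
  fix n f
  assume f: "(n, f) \<in> Pol (tuples d) M"
  have "g \<in> M" if "g \<in> trl d n f" for g
  proof -
    from that obtain p u where p: "length p = n" "count_list p None + u \<le> d"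
      and g: "g = restrict (\<lambda>xs. f (fill p (take (count_list p None) (drop u xs)))) (tuples d)"
      by (rule trlE)
    have "(d, g) \<in> Pol (tuples d) M"
      unfolding g using p fill_nth[OF p(2)] d_pos
      by (intro clone_substitute[OF clone_Pol_M const_Pol[OF const] f]) auto
    then show ?thesis by (rule Pol_arity_part)
  qed
  then show "(n, f) \<in> star d M"
    using f by (auto simp: star_def Pol_def)
qed

text \<open>Replacing the only variable of the unary projection by \<open>c\<close> gives the
  constant as a translation.\<close>

lemma const_M_if_clone_star:
  assumes "clone (star d M)"
  shows "restrict (\<lambda>_. c) (tuples d) \<in> M"
proof -
  have "trl d 1 (proj 1 0) \<subseteq> M"
    using clone_proj[OF assms, of 0 1] by (auto simp: star_def)
  moreover have "restrict (\<lambda>_. c) (tuples d) \<in> trl d 1 (proj 1 0)"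
    using trlI[of "[Some c]" 1 0 d "proj 1 0"] by simp
  ultimately show ?thesis by blast
qed

text \<open>Members of \<open>M\<close> are polymorphisms and hence in \<open>star d M\<close>;
  conversely, a \<open>d\<close>-ary function is its own translation under the pattern without
  constants.\<close>

lemma arity_part_star:
  assumes const: "\<And>c. restrict (\<lambda>_. c) (tuples d) \<in> M"
  shows "arity_part d (star d M) = M"
proof
  show "M \<subseteq> arity_part d (star d M)"
    using M_subset_Pol Pol_subset_star[OF const] by (auto simp: arity_part_def)
  show "arity_part d (star d M) \<subseteq> M"
  proof
    fix f assume "f \<in> arity_part d (star d M)"
    then have f: "f \<in> funs d" "trl d d f \<subseteq> M"
      by (auto simp: arity_part_def star_def Op_def)
    have count: "count_list (replicate d None) (None :: 'a option) = d"
      by (induction d) auto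
    have "restrict (\<lambda>xs. f (fill (replicate d None) (take d (drop 0 xs)))) (tuples d) \<in> trl d d f"
      using trlI[of "replicate d None" d 0 d f] count by simp
    also have "restrict (\<lambda>xs. f (fill (replicate d None) (take d (drop 0 xs)))) (tuples d) = f"
      using f by (intro funs_eqI[of _ d]) (auto simp: fill_replicate_None)
    finally show "f \<in> M" using f by blast
  qed
qed

section \<open>Generalized quasiorders from clones\<close>

text \<open>A translation keeps at most \<open>d < n + 1\<close> variables, so its pattern contains
  a constant. Substituting that one first gives a member of \<open>ebtrl n h\<close>, of which the
  function is again a translation.\<close>

lemma star_if_ebtrl:
  assumes h: "h \<in> funs (n + 1)" and "d \<le> n" and ebtrl: "ebtrl n h \<subseteq> arity_part n (star d M)"
  shows "(n + 1, h) \<in> star d M"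
proof -
  have "g \<in> M" if g: "g \<in> trl d (n + 1) h" for g
  proof -
    from g obtain p u where p: "length p = n + 1" "count_list p None + u \<le> d"
      and g: "g = restrict (\<lambda>xs. h (fill p (take (count_list p None) (drop u xs)))) (tuples d)"
      by (rule trlE)
    have "\<exists>c. Some c \<in> set p"
    proof (rule ccontr)
      assume "\<nexists>c. Some c \<in> set p"
      then have "\<forall>q\<in>set p. q = None" by (metis option.exhaust)
      then have "filter ((=) None) p = p" by (auto simp: filter_id_conv)
      then have "count_list p None = n + 1" using p by (simp add: count_list_eq_length_filter)
      then show False using p \<open>d \<le> n\<close> by simp
    qed
    then obtain c p1 p2 where ps: "p = p1 @ Some c # p2" by (meson split_list)
    define h' where "h' = restrict (\<lambda>xs. h (take (length p1) xs @ c # drop (length p1) xs)) (tuples n)"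
    have "h' \<in> ebtrl n h"
      using p ps by (auto simp: ebtrl_def h'_def)
    then have "trl d n h' \<subseteq> M"
      using ebtrl by (auto simp: arity_part_def star_def)
    moreover have "restrict (\<lambda>xs. h' (fill (p1 @ p2) (take (count_list (p1 @ p2) None) (drop u xs)))) (tuples d) \<in> trl d n h'"
      using p ps by (intro trlI) auto
    moreover have "restrict (\<lambda>xs. h' (fill (p1 @ p2) (take (count_list (p1 @ p2) None) (drop u xs)))) (tuples d) = g"
      unfolding g ps fill_insert_Some using p ps by (auto intro!: funs_eqI[of _ d] simp: h'_def)
    ultimately show ?thesis by auto
  qed
  then show ?thesis
    using h by (auto simp: star_def Op_def)
qed

text \<open>All functions in question arise from members of the clone by substituting constants and
  variables. For transitivity, \<open>star_if_ebtrl\<close> first brings \<open>h\<close> into the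
  clone.\<close>

lemma gen_quasiorder_arity_part_star:
  assumes C: "clone (star d M)" and "d \<le> n"
  shows "gen_quasiorder n (arity_part n (star d M))"
proof -
  have "1 \<le> n" using d_pos \<open>d \<le> n\<close> by simp
  have const: "(m, restrict (\<lambda>_. c) (tuples m)) \<in> star d M" if "1 \<le> m" for m c
    using const_Pol Pol_subset_star const_M_if_clone_star[OF C] that by blast
  note substitute = clone_substitute[OF C const]
  have "eftrl n g \<subseteq> circledast n (arity_part n (star d M))" if g: "(n, g) \<in> star d M" for g
  proof -
    have "(n, restrict (\<lambda>xs. g (tl (take i xs @ c # drop i xs))) (tuples n)) \<in> star d M"
      if "i \<le> n" for i c
    proof (rule substitute[OF \<open>1 \<le> n\<close> g])
      fix k assume k: "k < n"
      consider "Suc k < i" | "Suc k = i" | "i < Suc k" by linarith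
      then show "(\<exists>c'. \<forall>xs\<in>tuples n. tl (take i xs @ c # drop i xs) ! k = c') \<or>
          (\<exists>j<n. \<forall>xs\<in>tuples n. tl (take i xs @ c # drop i xs) ! k = xs ! j)"
      proof cases
        case 1
        then show ?thesis using that k
          by (intro disjI2 exI[of _ "Suc k"]) (auto simp: nth_tl nth_append)
      next
        case 2
        then show ?thesis using that k
          by (intro disjI1 exI[of _ c]) (auto simp: nth_tl nth_append)
      next
        case 3
        then show ?thesis using that k
          by (intro disjI2 exI[of _ k]) (auto simp: nth_tl nth_append)
      qed
    qed (use that in auto)
    moreover have "(n, restrict (\<lambda>xs. g (butlast (take i xs @ c # drop i xs))) (tuples n)) \<in> star d M"
      if "i \<le> n" for i c
    proof (rule substitute[OF \<open>1 \<le> n\<close> g])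
      fix k assume k: "k < n"
      consider "k < i" | "k = i" | "i < k" by linarith
      then show "(\<exists>c'. \<forall>xs\<in>tuples n. butlast (take i xs @ c # drop i xs) ! k = c') \<or>
          (\<exists>j<n. \<forall>xs\<in>tuples n. butlast (take i xs @ c # drop i xs) ! k = xs ! j)"
      proof cases
        case 1
        then show ?thesis using that k
          by (intro disjI2 exI[of _ k]) (auto simp: nth_butlast nth_append)
      next
        case 2
        then show ?thesis using that k
          by (intro disjI1 exI[of _ c]) (auto simp: nth_butlast nth_append)
      next
        case 3
        then show ?thesis using that k
          by (intro disjI2 exI[of _ "k - 1"]) (auto simp: nth_butlast nth_append nth_Cons')
      qed
    qed (use that in auto)
    moreover have "restrict (\<lambda>xs. restrict G (tuples (n + 1)) (take i xs @ c # drop i xs)) (tuples n) =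
        restrict (\<lambda>xs. G (take i xs @ c # drop i xs)) (tuples n)" if "i \<le> n" for i c and G :: "'a list \<Rightarrow> 'a"
      using that by (auto intro: restrict_ext)
    ultimately show ?thesis
      by (auto simp: eftrl_def circledast_def ebtrl_def arity_part_def simp del: restrict_apply)
  qed
  then have "internally_reflexive n (arity_part n (star d M))"
    by (auto simp: internally_reflexive_def arity_part_def)
  moreover have "diag n h \<subseteq> arity_part n (star d M)" if "h \<in> circledast n (arity_part n (star d M))" for h
  proof -
    have h: "(n + 1, h) \<in> star d M"
      using that \<open>d \<le> n\<close> by (intro star_if_ebtrl) (auto simp: circledast_def)
    have "(n, restrict (\<lambda>xs. h (take j xs @ xs ! i # drop j xs)) (tuples n)) \<in> star d M"
      if "i < j" "j \<le> n" for i j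
    proof (rule substitute[OF \<open>1 \<le> n\<close> h])
      fix k assume k: "k < n + 1"
      have "\<forall>xs\<in>tuples n. (take j xs @ xs ! i # drop j xs) ! k =
          xs ! (if k < j then k else if k = j then i else k - 1)"
        using that by (auto simp: nth_append nth_Cons')
      moreover have "(if k < j then k else if k = j then i else k - 1) < n"
        using that k by auto
      ultimately show "(\<exists>c. \<forall>xs\<in>tuples n. (take j xs @ xs ! i # drop j xs) ! k = c) \<or>
          (\<exists>l<n. \<forall>xs\<in>tuples n. (take j xs @ xs ! i # drop j xs) ! k = xs ! l)"
        by blast
    qed (use that in auto)
    then show ?thesis
      by (auto simp: diag_def arity_part_def)
  qed
  ultimately show ?thesis
    using const[OF \<open>1 \<le> n\<close>]
    by (auto simp: gen_quasiorder_def reflexive_rel_def transitive_rel_def arity_part_def star_def Op_def)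
qed

section \<open>The equivalences\<close>

text \<open>Closes a cycle: a clone \<open>star d M\<close> has \<open>M\<close> as its
  \<open>d\<close>-ary part, which is thus a generalized quasiorder; this yields equality with the
  polymorphisms; and these always form a clone.\<close>

lemma clone_star_iff_gen_quasiorder: "clone (star d M) \<longleftrightarrow> gen_quasiorder d M"
  and gen_quasiorder_iff_star_eq_Pol: "gen_quasiorder d M \<longleftrightarrow> star d M = Pol (tuples d) M"
proof -
  have "gen_quasiorder d M" if "clone (star d M)"
    using gen_quasiorder_arity_part_star[OF that order_refl]
      arity_part_star[OF const_M_if_clone_star[OF that]] by simp
  moreover have "star d M = Pol (tuples d) M" if "gen_quasiorder d M"
    using that star_subset_Pol Pol_subset_star
    by (intro equalityI) (auto simp: gen_quasiorder_def reflexive_rel_def)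
  ultimately show "clone (star d M) \<longleftrightarrow> gen_quasiorder d M"
    and "gen_quasiorder d M \<longleftrightarrow> star d M = Pol (tuples d) M"
    using clone_Pol_M by auto
qed

end

text \<open>\<open>M\<close> is the \<open>d\<close>-ary part of an intersection of clones, so
  projections and compositions can be checked in each of these clones.\<close>

lemma fragment_if_clone_fragment:
  assumes "1 \<le> d" "clone_fragment d M"
  shows "fragment d M"
proof
  have M: "M \<subseteq> funs d" "\<And>f. f \<in> M \<longleftrightarrow> (d, f) \<in> generated_clone ({d} \<times> M)"
    using assms by (auto simp: clone_fragment_def arity_part_def)
  show "M \<subseteq> funs d" by fact
  show "proj d i \<in> M" if "i < d" for i
    unfolding M(2) generated_clone_def using that by (auto intro: clone_proj)
  show "compose_on (tuples d) f gs \<in> M" if "f \<in> M" "length gs = d" "set gs \<subseteq> M" for f gs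
    unfolding M(2) generated_clone_def using that by (auto intro!: clone_compose)
qed fact

theorem proposition7p2:
  fixes d :: nat and M :: "('a::finite list \<Rightarrow> 'a) set"
  assumes "d \<ge> 1" and "clone_fragment d M"
  shows "(clone (star d M) \<longleftrightarrow> gen_quasiorder d M) \<and>
         (gen_quasiorder d M \<longleftrightarrow> star d M = Pol (tuples d) M) \<and>
         (gen_quasiorder d M \<longrightarrow>
            (\<forall>n\<ge>d. gen_quasiorder n (arity_part n (star d M))))"
proof -
  interpret fragment d M
    using assms by (rule fragment_if_clone_fragment)
  \<comment> \<open>For the last claim, the quasiorder condition is first turned into
    \<open>clone (star d M)\<close>.\<close>
  show ?thesis
    using clone_star_iff_gen_quasiorder gen_quasiorder_iff_star_eq_Pol gen_quasiorder_arity_part_star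
    by blast
qed

end
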